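(* Let $a,b\in\mathbb{R}$ with $a=b$ and let $G$ be the Green's function of the problem $u'(t)+a\,u(-t)+b\,u(t)=h(t)$ for a.e. $t\in\mathbb{R}$, $u(t_0)=c$ (given in the context). Then: (i) if $0<a$, $G$ is non-negative on $[0,1/a]\times\mathbb{R}$; (ii) if $a<0$, $G$ is non-positive on $[1/a,0]\times\mathbb{R}$; (iii) $G$ changes sign in any other strip not a subset of the aforementioned.
   Context: Here $h\in L^1_{\mathrm{loc}}(\mathbb{R})$ and $t_0,c\in\mathbb{R}$. Strips are sets of the kind $[\alpha,\beta]\times\mathbb{R}$ in the $(t,s)$-plane. For $t_1,t_2\in\mathbb{R}$ the oriented characteristic function is $\chi_{t_1}^{t_2}(t)=1$ if $t_1\le t\le t_2$, $\chi_{t_1}^{t_2}(t)=-1$ if $t_2\le t<t_1$, and $0$ otherwise. The Green's function is $$G(t,s)=\tfrac12\Big(\big[\tilde u(-s)\tilde v(t)+\tilde v(-s)\tilde u(t)\big]\chi_0^t(s)+\big[\tilde u(-s)\tilde v(t)-\tilde v(-s)\tilde u(t)\big]\chi_{-t}^0(s)\Big),\quad t,s\in\mathbb{R},$$ where $\tilde u'(t)+a\tilde u(-t)+b\tilde u(t)=0$, $\tilde u(0)=1$ and $\tilde v'(t)-a\tilde v(-t)+b\tilde v(t)=0$, $\tilde v(0)=1$. For $a=b$ it is $$G(t,s)=[1+a(s-t)]\,\chi_0^t(s)+a(s+t)\,\chi_{-t}^0(s),$$ which is rewritten as: $1+a(s-t)$ for $0\le s\le t$; $-1-a(s-t)$ for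 $t\le s\le 0$; $a(s+t)$ for $-t\le s\le 0$; $-a(s+t)$ for $0\le s\le -t$; and $0$ otherwise.
   Formalization: In (ii) the single point (t,s)=(0,0) is excluded, since the given formula yields G(0,0)=1>0; (iii) is stated only for a≠0, since for a=b=0 no strip is named and G is non-negative on, e.g., [1,2]×ℝ. *)

theory Defs
  imports "HOL-Analysis.Analysis"
begin

definition oriented_char :: "real \<Rightarrow> real \<Rightarrow> real \<Rightarrow> real" where
  "oriented_char t1 t2 t =
     (if t1 \<le> t \<and> t \<le> t2 then 1 else if t2 \<le> t \<and> t < t1 then -1 else 0)"

definition reflection_solution :: "real \<Rightarrow> real \<Rightarrow> (real \<Rightarrow> real) \<Rightarrow> bool" where
  "reflection_solution a b w \<longleftrightarrow>
     (\<forall>t. w differentiable (at t) \<and> deriv w t + a * w (- t) + b * w t = 0) \<and> w 0 = 1"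

text \<open>
  The Green's function of \<open>u'(t) + a u(-t) + b u(t) = h(t)\<close>, \<open>u(t0) = c\<close>
  depends only on \<open>a\<close> and \<open>b\<close>, not on the data \<open>h\<close>, \<open>t0\<close>, \<open>c\<close>. The values at
  the end points of the intervals are those given by \<^const>\<open>oriented_char\<close>;
  in particular \<open>G 0 0 = 1\<close>.
\<close>

definition is_green_function :: "real \<Rightarrow> real \<Rightarrow> (real \<Rightarrow> real \<Rightarrow> real) \<Rightarrow> bool" where
  "is_green_function a b G \<longleftrightarrow>
     (\<exists>u v. reflection_solution a b u \<and> reflection_solution (- a) b v \<and>
        (\<forall>t s. G t s = 1 / 2 *
           ((u (- s) * v t + v (- s) * u t) * oriented_char 0 t s
          + (u (- s) * v t - v (- s) * u t) * oriented_char (- t) 0 s)))"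

definition strip :: "real \<Rightarrow> real \<Rightarrow> (real \<times> real) set" where
  "strip \<alpha> \<beta> = {\<alpha>..\<beta>} \<times> UNIV"

definition changes_sign_on :: "(real \<Rightarrow> real \<Rightarrow> real) \<Rightarrow> (real \<times> real) set \<Rightarrow> bool" where
  "changes_sign_on G S \<longleftrightarrow> (\<exists>(t, s)\<in>S. G t s > 0) \<and> (\<exists>(t, s)\<in>S. G t s < 0)"

end

theory Submission
  imports Defs
begin

text \<open>
  For \<open>a = b\<close> the two homogeneous problems have elementary solutions. The equation
  \<open>u'(t) = - a (u(t) + u(-t))\<close> makes the even part of \<open>u\<close> constant, hence \<open>u'\<close> constant and
  \<open>u(t) = 1 - 2 a t\<close>; the equation \<open>v'(t) = - a (v(t) - v(-t))\<close> makes the odd part of \<open>v\<close>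
  constant, hence zero, and \<open>v = 1\<close>. So \<open>G\<close> is uniquely determined and is piecewise affine
  (\<open>green_function_affine\<close>): on the vertical line at \<open>t\<close> it is supported in \<open>\<bar>s\<bar> \<le> \<bar>t\<bar>\<close>, and up to
  the sign of \<open>t\<close> it is \<open>1 + a (s - t)\<close> where \<open>s\<close> lies on the same side of \<open>0\<close> as \<open>t\<close>, and
  \<open>a (s + t)\<close> where it lies on the other side.

  The second piece takes the sign of \<open>a\<close>, whichever side \<open>t\<close> is on. The first piece takes the
  sign of \<open>t\<close> at \<open>s = t\<close>, and its value tends to \<open>1 - a t\<close>, up to that sign, as \<open>s\<close>
  tends to \<open>0\<close>. Hence, for \<open>a \<noteq> 0\<close>, the line at \<open>t \<noteq> 0\<close> carries a single sign exactly when
  \<open>t\<close> has the sign of \<open>a\<close> and \<open>a t \<le> 1\<close>. On every other line with \<open>t \<noteq> 0\<close> both signs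
  already occur, so a strip containing such a line inherits the change of sign.
\<close>

section \<open>The solutions of the homogeneous problems\<close>

lemma reflection_solution_has_derivative:
  assumes "reflection_solution a b w"
  shows "(w has_real_derivative - a * w (- t) - b * w t) (at t)"
proof -
  have "w differentiable (at t)" and "deriv w t = - a * w (- t) - b * w t"
    using assms by (auto simp: reflection_solution_def algebra_simps eq_neg_iff_add_eq_0)
  then show ?thesis
    by (metis DERIV_deriv_iff_real_differentiable)
qed

lemma reflection_solution_reflected_has_derivative:
  assumes "reflection_solution a b w"
  shows "((\<lambda>x. w (- x)) has_real_derivative a * w t + b * w (- t)) (at t)"
  using DERIV_mirror[THEN iffD1,
      OF reflection_solution_has_derivative[OF assms, of "- t"]]
  by (simp add: add.commute)

text \<open>The even part is constant because \<open>u'\<close> is an even function of \<open>t\<close>.\<close>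

lemma reflection_solution_equal_coefficients:
  assumes "reflection_solution a a u"
  shows "u t = 1 - 2 * a * t"
proof -
  note d = reflection_solution_has_derivative[OF assms]
  note d' = reflection_solution_reflected_has_derivative[OF assms]
  have u0: "u 0 = 1"
    using assms by (simp add: reflection_solution_def)
  have "((\<lambda>x. u x + u (- x)) has_real_derivative 0) (at x)" for x
    using DERIV_add[OF d[of x] d'[of x]] by simp
  then have even_part: "u x + u (- x) = 2" for x
    using DERIV_isconst_all[of "\<lambda>x. u x + u (- x)" x 0] u0 by simp
  have "((\<lambda>x. u x + 2 * a * x) has_real_derivative 0) (at x)" for x
  proof -
    have "- a * u (- x) - a * u x = - a * (u x + u (- x))"
      by (simp add: algebra_simps)
    then have "(u has_real_derivative - 2 * a) (at x)"
      using d[of x] by (simp add: even_part mult.commute)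
    then show ?thesis
      by (auto intro!: derivative_eq_intros)
  qed
  then show ?thesis
    using DERIV_isconst_all[of "\<lambda>x. u x + 2 * a * x" t 0] u0 by simp
qed

text \<open>Here \<open>v'\<close> is odd, so it is the odd part that is constant, and it vanishes at \<open>0\<close>.\<close>

lemma reflection_solution_opposite_coefficients:
  assumes "reflection_solution (- a) a v"
  shows "v t = 1"
proof -
  note d = reflection_solution_has_derivative[OF assms]
  note d' = reflection_solution_reflected_has_derivative[OF assms]
  have v0: "v 0 = 1"
    using assms by (simp add: reflection_solution_def)
  have "((\<lambda>x. v x - v (- x)) has_real_derivative 0) (at x)" for x
    using DERIV_diff[OF d[of x] d'[of x]] by simp
  then have odd_part: "v (- x) = v x" for x
    using DERIV_isconst_all[of "\<lambda>x. v x - v (- x)" x 0] by simp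
  have "(v has_real_derivative 0) (at x)" for x
    using d[of x] by (simp add: odd_part)
  then show ?thesis
    using DERIV_isconst_all[of v t 0] v0 by simp
qed

section \<open>The Green's function for equal coefficients\<close>

lemma green_function_affine:
  assumes "is_green_function a a G"
  shows "G t s = (1 + a * (s - t)) * oriented_char 0 t s
               + a * (s + t) * oriented_char (- t) 0 s"
proof -
  obtain u v where u: "reflection_solution a a u" and v: "reflection_solution (- a) a v"
    and G: "G t s = 1 / 2 *
           ((u (- s) * v t + v (- s) * u t) * oriented_char 0 t s
          + (u (- s) * v t - v (- s) * u t) * oriented_char (- t) 0 s)"
    using assms by (auto simp: is_green_function_def)
  show ?thesis
    unfolding G reflection_solution_equal_coefficients[OF u]
      reflection_solution_opposite_coefficients[OF v]
    by (simp add: field_simps)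
qed

text \<open>
  At \<open>s = 0\<close> both pieces contribute when \<open>t \<ge> 0\<close>, which gives the value \<open>1\<close>; when \<open>t < 0\<close>
  the orientation assigns \<open>s = 0\<close> to the second piece alone.
\<close>

lemma green_function_right:
  assumes "is_green_function a a G" and "t \<ge> 0"
  shows "G t s = (if s = 0 then 1
                  else if 0 < s \<and> s \<le> t then 1 + a * (s - t)
                  else if - t \<le> s \<and> s < 0 then a * (s + t)
                  else 0)"
  using assms(2) by (auto simp: green_function_affine[OF assms(1)] oriented_char_def algebra_simps)

lemma green_function_left:
  assumes "is_green_function a a G" and "t < 0"
  shows "G t s = (if t \<le> s \<and> s < 0 then - (1 + a * (s - t))
                  else if 0 \<le> s \<and> s < - t then - (a * (s + t))
                  else 0)"
  using assms(2) by (auto simp: green_function_affine[OF assms(1)] oriented_char_def algebra_simps)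

section \<open>Lines of constant sign\<close>

lemma green_function_nonneg:
  assumes G: "is_green_function a a G" and "0 < a" and t: "0 \<le> t" "t \<le> 1 / a"
  shows "G t s \<ge> 0"
proof -
  have "a * t \<le> 1"
    using t \<open>0 < a\<close> by (simp add: field_simps)
  moreover have "a * s > 0" if "0 < s"
    using that \<open>0 < a\<close> by simp
  moreover have "a * (s + t) \<ge> 0" if "- t \<le> s"
    using that \<open>0 < a\<close> by simp
  ultimately show ?thesis
    by (auto simp: green_function_right[OF G t(1)] right_diff_distrib)
qed

text \<open>The origin is a genuine exception: \<open>G 0 0 = 1\<close>, while \<open>G 0 s = 0\<close> for \<open>s \<noteq> 0\<close>.\<close>

lemma green_function_nonpos:
  assumes G: "is_green_function a a G" and "a < 0" and t: "1 / a \<le> t" "t \<le> 0"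
    and not_origin: "(t, s) \<noteq> (0, 0)"
  shows "G t s \<le> 0"
proof (cases "t = 0")
  case True
  then show ?thesis
    using not_origin by (auto simp: green_function_right[OF G])
next
  case False
  then have "t < 0"
    using t by simp
  have "a * t \<le> 1"
    using t \<open>a < 0\<close> by (simp add: field_simps)
  moreover have "a * s > 0" if "s < 0"
    using that \<open>a < 0\<close> by (simp add: mult_neg_neg)
  moreover have "a * (s + t) \<ge> 0" if "s < - t"
    using that \<open>a < 0\<close> by (intro mult_nonpos_nonpos) auto
  ultimately show ?thesis
    by (auto simp: green_function_left[OF G \<open>t < 0\<close>] right_diff_distrib)
qed

section \<open>Lines on which the sign changes\<close>

lemma changes_sign_on_stripI:
  assumes "t \<in> {\<alpha>..\<beta>}" and "G t p > 0" and "G t n < 0"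
  shows "changes_sign_on G (strip \<alpha> \<beta>)"
  using assms by (force simp: changes_sign_on_def strip_def)

lemma strip_not_subset_obtains:
  assumes "\<not> strip \<alpha> \<beta> \<subseteq> strip \<gamma> \<delta>"
  obtains t where "t \<in> {\<alpha>..\<beta>}" and "t < \<gamma> \<or> \<delta> < t"
  using assms by (force simp: strip_def)

text \<open>
  When \<open>a t > 1\<close>, the point \<open>s = (t - 1/a) / 2\<close> lies strictly between \<open>0\<close> and the zero
  \<open>s = t - 1/a\<close> of the piece \<open>1 + a (s - t)\<close>, so that this piece has changed its sign there.
\<close>

lemma first_piece_neg_at_midpoint:
  fixes a t :: real
  assumes "a \<noteq> 0" and "1 < a * t"
  shows "1 + a * ((t - 1 / a) / 2 - t) < 0"
proof -
  define z where "z = 1 / a"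
  have "a * z = 1"
    using assms(1) by (simp add: z_def)
  moreover have "a * ((t - z) / 2 - t) = - (a * t + a * z) / 2"
    by (simp add: field_simps)
  ultimately have "1 + a * ((t - z) / 2 - t) < 0"
    using assms(2) by simp
  then show ?thesis
    by (simp only: z_def)
qed

lemma green_function_pos_coefficient_both_signs:
  assumes G: "is_green_function a a G" and "0 < a" and t: "t < 0 \<or> 1 / a < t"
  obtains p n where "G t p > 0" and "G t n < 0"
proof (cases "t < 0")
  case True
  have "G t 0 > 0" and "G t t < 0"
    using True \<open>0 < a\<close> by (auto simp: green_function_left[OF G True] mult_pos_neg)
  then show ?thesis
    by (rule that)
next
  case False
  then have gt: "1 / a < t"
    using t by simp
  define z where "z = 1 / a"
  define m where "m = (t - z) / 2"
  have "0 < z" and "z < t"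
    using gt \<open>0 < a\<close> by (simp_all add: z_def)
  then have m: "0 < m" "m \<le> t" and "t > 0"
    using \<open>0 < z\<close> \<open>z < t\<close> by (simp_all add: m_def)
  have "1 < a * t"
    using gt \<open>0 < a\<close> by (simp add: field_simps)
  then have "1 + a * (m - t) < 0"
    using first_piece_neg_at_midpoint[of a t] \<open>0 < a\<close> by (simp add: m_def z_def)
  then have "G t t > 0" and "G t m < 0"
    using m \<open>t > 0\<close> by (auto simp: green_function_right[OF G])
  then show ?thesis
    by (rule that)
qed

lemma green_function_neg_coefficient_both_signs:
  assumes G: "is_green_function a a G" and "a < 0" and t: "t < 1 / a \<or> 0 < t"
  obtains p n where "G t p > 0" and "G t n < 0"
proof (cases "0 < t")
  case True
  have "G t t > 0" and "G t (- t / 2) < 0"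
    using True \<open>a < 0\<close> by (auto simp: green_function_right[OF G] mult_neg_pos)
  then show ?thesis
    by (rule that)
next
  case False
  then have lt: "t < 1 / a"
    using t by simp
  define z where "z = 1 / a"
  define m where "m = (t - z) / 2"
  have "z < 0" and "t < z"
    using lt \<open>a < 0\<close> by (simp_all add: z_def)
  then have m: "t \<le> m" "m < 0" and "t < 0"
    using \<open>z < 0\<close> \<open>t < z\<close> by (simp_all add: m_def)
  have "1 < a * t"
    using lt \<open>a < 0\<close> by (simp add: field_simps)
  then have "1 + a * (m - t) < 0"
    using first_piece_neg_at_midpoint[of a t] \<open>a < 0\<close> by (simp add: m_def z_def)
  then have "G t m > 0" and "G t t < 0"
    using m \<open>t < 0\<close> by (auto simp: green_function_left[OF G \<open>t < 0\<close>])
  then show ?thesis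
    by (rule that)
qed

section \<open>The maximal strips of constant sign\<close>

theorem lemma3p6:
  fixes a b :: real and G :: "real \<Rightarrow> real \<Rightarrow> real"
  assumes "a = b" and "is_green_function a b G"
  shows "(0 < a \<longrightarrow> (\<forall>(t, s)\<in>strip 0 (1 / a). G t s \<ge> 0))
       \<and> (a < 0 \<longrightarrow> (\<forall>(t, s)\<in>strip (1 / a) 0 - {(0, 0)}. G t s \<le> 0))
       \<and> (0 < a \<longrightarrow> (\<forall>\<alpha> \<beta>. \<not> strip \<alpha> \<beta> \<subseteq> strip 0 (1 / a) \<longrightarrow> changes_sign_on G (strip \<alpha> \<beta>)))
       \<and> (a < 0 \<longrightarrow> (\<forall>\<alpha> \<beta>. \<not> strip \<alpha> \<beta> \<subseteq> strip (1 / a) 0 \<longrightarrow> changes_sign_on G (strip \<alpha> \<beta>)))"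
proof -
  have G: "is_green_function a a G"
    using assms by simp
  have "\<forall>(t, s)\<in>strip 0 (1 / a). G t s \<ge> 0" if "0 < a"
    using green_function_nonneg[OF G that] by (auto simp: strip_def)
  moreover have "\<forall>(t, s)\<in>strip (1 / a) 0 - {(0, 0)}. G t s \<le> 0" if "a < 0"
  proof (rule ballI, rule case_prodI2)
    fix p t s
    assume "p \<in> strip (1 / a) 0 - {(0, 0)}" and "p = (t, s)"
    then show "G t s \<le> 0"
      by (intro green_function_nonpos[OF G that]) (simp_all add: strip_def)
  qed
  moreover have "changes_sign_on G (strip \<alpha> \<beta>)"
    if a: "0 < a" and strip: "\<not> strip \<alpha> \<beta> \<subseteq> strip 0 (1 / a)" for \<alpha> \<beta>
  proof -
    obtain t where t: "t \<in> {\<alpha>..\<beta>}" "t < 0 \<or> 1 / a < t"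
      using strip_not_subset_obtains[OF strip] .
    obtain p n where "G t p > 0" and "G t n < 0"
      using green_function_pos_coefficient_both_signs[OF G a t(2)] .
    with t(1) show ?thesis
      by (rule changes_sign_on_stripI)
  qed
  moreover have "changes_sign_on G (strip \<alpha> \<beta>)"
    if a: "a < 0" and strip: "\<not> strip \<alpha> \<beta> \<subseteq> strip (1 / a) 0" for \<alpha> \<beta>
  proof -
    obtain t where t: "t \<in> {\<alpha>..\<beta>}" "t < 1 / a \<or> 0 < t"
      using strip_not_subset_obtains[OF strip] .
    obtain p n where "G t p > 0" and "G t n < 0"
      using green_function_neg_coefficient_both_signs[OF G a t(2)] .
    with t(1) show ?thesis
      by (rule changes_sign_on_stripI)
  qed
  ultimately show ?thesis
    by blast
qed

end
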